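(* (1) For every integer $k\ge 2$ there is a homomorphism $\mathrm{SG}(2k+2,k)\to S_4$. (2) For every positive integer $k$ there is no homomorphism $\mathrm{KG}(2k+2,k)\to S_4$.
   Context: The Kneser graph $\mathrm{KG}(n,k)$ ($n\ge 2k$) has as vertices all $k$-element subsets of $[n]=\{1,\dots,n\}$, two being adjacent iff they are disjoint. The Schrijver graph $\mathrm{SG}(n,k)$ is the induced subgraph of $\mathrm{KG}(n,k)$ on the stable $k$-subsets, i.e., those $A$ containing no pair $\{i,i+1\}$ for $i\in[n-1]$ and not containing both $1$ and $n$. The symmetric shift graph $S_m$ has vertex set $\{(i,j):1\le i,j\le m,\ i\ne j\}$, and $(i,j)$ is adjacent to $(k,\ell)$ iff $j=k$ or $i=\ell$. A homomorphism is an edge-preserving map between vertex sets. *)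

theory Defs
  imports Main
begin

definition kneser_vertices :: "nat \<Rightarrow> nat \<Rightarrow> nat set set" where
  "kneser_vertices n k = {A. A \<subseteq> {1..n} \<and> card A = k}"

definition kneser_adj :: "nat set \<Rightarrow> nat set \<Rightarrow> bool" where
  "kneser_adj A B \<longleftrightarrow> A \<inter> B = {}"

definition stable_set :: "nat \<Rightarrow> nat set \<Rightarrow> bool" where
  "stable_set n A \<longleftrightarrow>
     (\<forall>i\<in>{1..<n}. \<not> (i \<in> A \<and> Suc i \<in> A)) \<and> \<not> (1 \<in> A \<and> n \<in> A)"

definition schrijver_vertices :: "nat \<Rightarrow> nat \<Rightarrow> nat set set" where
  "schrijver_vertices n k = {A \<in> kneser_vertices n k. stable_set n A}"

definition shift_vertices :: "nat \<Rightarrow> (nat \<times> nat) set" where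
  "shift_vertices m = {(i, j). i \<in> {1..m} \<and> j \<in> {1..m} \<and> i \<noteq> j}"

definition shift_adj :: "nat \<times> nat \<Rightarrow> nat \<times> nat \<Rightarrow> bool" where
  "shift_adj p q \<longleftrightarrow> snd p = fst q \<or> fst p = snd q"

definition graph_hom ::
  "'a set \<Rightarrow> ('a \<Rightarrow> 'a \<Rightarrow> bool) \<Rightarrow> 'b set \<Rightarrow> ('b \<Rightarrow> 'b \<Rightarrow> bool) \<Rightarrow> ('a \<Rightarrow> 'b) \<Rightarrow> bool" where
  "graph_hom V E W F f \<longleftrightarrow>
     (\<forall>x\<in>V. f x \<in> W) \<and> (\<forall>x\<in>V. \<forall>y\<in>V. E x y \<longrightarrow> F (f x) (f y))"

end

theory Submission
  imports Defs "HOL-Library.Disjoint_Sets" "HOL-Library.Z2"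
begin

text \<open>
  For (1), deleting the maximum maps \<open>SG(n+2,k+1)\<close> to \<open>SG(n,k)\<close>, so it suffices to map
  \<open>SG(6,2)\<close> to \<open>S\<^sub>4\<close>.

  For (2), let \<open>n = 2k+2\<close>. The first coordinate of a homomorphism is a proper 4-colouring \<open>c\<close> of
  \<open>KG(n,k)\<close>. Give a signed subset of \<open>[n]\<close> the sign of the side containing the \<open>k\<close>-set of largest
  colour, and the sign of its least element if neither side contains a \<open>k\<close>-set. By Ky Fan's lemma an
  odd number of maximal flags have signs \<open>+, -, +, \<dots>\<close>. Such a flag passes through disjoint
  \<open>(k-1)\<close>-sets \<open>A\<close>, \<open>B\<close> and then adds the other elements \<open>w, x, y, z\<close> to \<open>A, B, A, B\<close>, the largest
  colours becoming 1, 2, 3, 4 in turn. Fix \<open>A\<close>, \<open>B\<close> that occur an odd number of times. Exchanging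
  \<open>w\<close> with \<open>y\<close> or \<open>x\<close> with \<open>z\<close> cancels all orders in pairs except those where
  \<open>A \<union> {w}, B \<union> {x}, A \<union> {y}, B \<union> {z}\<close> themselves have colours 1, 2, 3, 4. Their number is the
  permanent of a 0-1 matrix. If \<open>c(A \<union> {s}) \<noteq> c(B \<union> {s})\<close> for some \<open>s\<close>, then exactly two colours
  fit each such \<open>s\<close>, so that this matrix is singular modulo 2; hence \<open>c(A \<union> {s}) = c(B \<union> {s})\<close> for
  all \<open>s\<close>.

  For each of the 12 pairs \<open>s \<noteq> s'\<close> the images of \<open>A \<union> {s}\<close> and \<open>B \<union> {s'}\<close> are adjacent in \<open>S\<^sub>4\<close>, so
  the second coordinate of one is the first coordinate of the other. But each of the eight second
  coordinates serves at most one pair, a contradiction.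
\<close>

section \<open>Counting modulo two\<close>

lemma even_card_if_even_fibres:
  assumes "finite A" "\<And>y. y \<in> h ` A \<Longrightarrow> even (card {x \<in> A. h x = y})"
  shows "even (card A)"
proof -
  have "card A = (\<Sum>y\<in>h ` A. card {x \<in> A. h x = y})"
    using sum.image_gen[OF assms(1), of "\<lambda>_. 1::nat" h] by simp
  then show ?thesis using assms(2) by (simp add: dvd_sum)
qed

lemma even_card_iff_even_card_fixpoints:
  assumes "finite A" "\<And>x. x \<in> A \<Longrightarrow> g x \<in> A" "\<And>x. x \<in> A \<Longrightarrow> g (g x) = x"
  shows "even (card A) \<longleftrightarrow> even (card {x \<in> A. g x = x})"
proof -
  let ?N = "{x \<in> A. g x \<noteq> x}"
  have "(\<Sum>x\<in>?N. 1 :: bit) = 0"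
    by (rule sum_involution_eq_0[where h = g]) (use assms(2,3) in auto)
  then have "even (of_nat (card ?N) :: bit)" by simp
  then have "even (card ?N)" by (simp only: even_of_nat)
  moreover have "card A = card ?N + card {x \<in> A. g x = x}"
    using assms(1) by (subst card_Un_disjoint[symmetric]) (auto intro: arg_cong[where f = card])
  ultimately show ?thesis by simp
qed

lemma even_card_Sigma_iff:
  assumes "finite A" "\<And>x. x \<in> A \<Longrightarrow> finite (B x)"
  shows "even (card (Sigma A B)) \<longleftrightarrow> even (card {x \<in> A. odd (card (B x))})"
  using assms by (simp add: even_sum_iff)

lemma even_sum_consecutive:
  fixes h :: "nat \<Rightarrow> nat"
  shows "even (\<Sum>i\<le>n. h i + h (Suc i)) \<longleftrightarrow> even (h 0 + h (Suc n))"
  by (induction n) auto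

definition switches_at :: "(nat \<Rightarrow> bool) \<Rightarrow> nat \<Rightarrow> nat \<Rightarrow> bool" where
  "switches_at t n i \<longleftrightarrow> i \<le> n \<and> (\<forall>j\<le>n. (j < i \<longrightarrow> t j) \<and> (i < j \<longrightarrow> \<not> t j))"

lemma odd_card_switches_at:
  "odd (card {i. switches_at t n i}) \<longleftrightarrow> (\<forall>j\<le>n. t j) \<or> (\<forall>j\<le>n. \<not> t j)"
proof -
  define cut where "cut a \<longleftrightarrow> (\<forall>j\<le>n. t j \<longleftrightarrow> j < a)" for a
  have switches_at_iff: "switches_at t n i \<longleftrightarrow> cut i \<or> cut (Suc i)" if "i \<le> n" for i
    using that by (auto simp: switches_at_def cut_def less_Suc_eq not_less)
      (metis le_neq_implies_less linorder_le_less_linear)+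
  have not_both: "\<not> (cut i \<and> cut (Suc i))" if "i \<le> n" for i
    using that by (auto simp: cut_def)
  have "{i. switches_at t n i} = {i. i \<le> n \<and> cut i} \<union> {i. i \<le> n \<and> cut (Suc i)}"
    using switches_at_iff by (auto simp: switches_at_def)
  then have "card {i. switches_at t n i} = card {i. i \<le> n \<and> cut i} + card {i. i \<le> n \<and> cut (Suc i)}"
    using not_both by (subst card_Un_disjoint[symmetric]) auto
  also have "\<dots> = (\<Sum>i\<le>n. of_bool (cut i) + of_bool (cut (Suc i)))"
    by (simp add: sum.distrib atMost_def Int_def conj_commute)
  finally have "odd (card {i. switches_at t n i}) \<longleftrightarrow>
      odd (of_bool (cut 0) + of_bool (cut (Suc n)) :: nat)"
    using even_sum_consecutive[of "\<lambda>i. of_bool (cut i)" n] by simp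
  also have "\<dots> \<longleftrightarrow> cut 0 \<or> cut (Suc n)"
    by (auto simp: cut_def)
  finally show ?thesis by (auto simp: cut_def less_Suc_eq_le)
qed

section \<open>Swapping list entries\<close>

definition list_swap :: "nat \<Rightarrow> nat \<Rightarrow> 'a list \<Rightarrow> 'a list" where
  "list_swap i j xs = xs[i := xs ! j, j := xs ! i]"

lemma length_list_swap [simp]: "length (list_swap i j xs) = length xs"
  by (simp add: list_swap_def)

lemma nth_list_swap:
  assumes "i < length xs" "j < length xs"
  shows "list_swap i j xs ! l = xs ! (if l = i then j else if l = j then i else l)"
  using assms by (auto simp: list_swap_def nth_list_update)

lemma set_list_swap [simp]:
  assumes "i < length xs" "j < length xs"
  shows "set (list_swap i j xs) = set xs"
  using assms by (simp add: list_swap_def)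

lemma distinct_list_swap [simp]:
  assumes "i < length xs" "j < length xs"
  shows "distinct (list_swap i j xs) \<longleftrightarrow> distinct xs"
  using assms by (simp add: list_swap_def)

lemma map_list_swap:
  assumes "i < length xs" "j < length xs"
  shows "map f (list_swap i j xs) = list_swap i j (map f xs)"
  using assms by (simp add: list_swap_def map_update)

lemma list_swap_list_swap [simp]:
  assumes "i < length xs" "j < length xs"
  shows "list_swap i j (list_swap i j xs) = xs"
  using assms by (intro nth_equalityI) (auto simp: nth_list_swap)

lemma list_swap_eq_iff:
  assumes "distinct xs" "i < length xs" "j < length xs"
  shows "list_swap i j xs = xs \<longleftrightarrow> i = j"
proof
  assume "list_swap i j xs = xs"
  then have "xs ! i = xs ! j" using assms nth_list_swap[of i xs j i] by simp
  then show "i = j" using assms by (simp add: nth_eq_iff_index_eq)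
qed (simp add: list_swap_def)

lemma set_take_list_swap_Suc:
  assumes "Suc i < length xs" "j \<noteq> i"
  shows "set (take (Suc j) (list_swap i (Suc i) xs)) = set (take (Suc j) xs)"
proof (cases "j < i")
  case False
  then have "i < j" using assms by simp
  then have "take (Suc j) (list_swap i (Suc i) xs) = list_swap i (Suc i) (take (Suc j) xs)"
    by (simp add: list_swap_def take_update_swap)
  then show ?thesis using assms(1) \<open>i < j\<close> by simp
qed (simp add: list_swap_def)

section \<open>Transversals\<close>

definition transversals :: "(nat \<Rightarrow> 'a \<Rightarrow> bool) \<Rightarrow> 'a set \<Rightarrow> 'a list set" where
  "transversals R S = {xs. distinct xs \<and> set xs = S \<and> (\<forall>i<card S. R i (xs ! i))}"

lemma finite_transversals:
  assumes "finite S"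
  shows "finite (transversals R S)"
proof (rule finite_subset)
  show "transversals R S \<subseteq> {xs. set xs \<subseteq> S \<and> length xs = card S}"
    by (auto simp: transversals_def distinct_card)
qed (use assms in \<open>simp add: finite_lists_length_eq\<close>)

text \<open>The number of transversals is a permanent, which modulo 2 is a determinant: adding all other
  columns to column \<open>k\<close> does not change it.\<close>
lemma even_card_transversals:
  assumes "finite S" "k < card S"
    and "\<And>xs. xs \<in> transversals (\<lambda>i s. i \<noteq> k \<longrightarrow> R i s) S \<Longrightarrow>
      even (card {i. i < card S \<and> R i (xs ! k)})"
  shows "even (card (transversals R S))"
proof -
  define Q where "Q = transversals (\<lambda>i s. i \<noteq> k \<longrightarrow> R i s) S"
  define P where "P = (SIGMA xs:Q. {i. i < card S \<and> R i (xs ! k)})"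
  define swap_k where "swap_k = (\<lambda>(xs :: 'a list, i). (list_swap i k xs, i))"
  have "finite Q" using finite_transversals assms(1) by (simp add: Q_def)
  then have "even (card P)"
    using assms(3) by (auto simp: P_def Q_def intro!: dvd_sum)
  have length: "length xs = card S" if "xs \<in> Q" for xs
    using that by (auto simp: Q_def transversals_def distinct_card)
  have swap_mem: "swap_k z \<in> P" if "z \<in> P" for z
    using that length assms(2)
    by (auto simp: P_def Q_def transversals_def swap_k_def nth_list_swap)
  have "even (card P) \<longleftrightarrow> even (card {z \<in> P. swap_k z = z})"
  proof (rule even_card_iff_even_card_fixpoints)
    show "finite P" using \<open>finite Q\<close> by (simp add: P_def)
    show "swap_k (swap_k z) = z" if "z \<in> P" for z
      using that length assms(2) by (auto simp: P_def swap_k_def)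
  qed (rule swap_mem)
  also have "{z \<in> P. swap_k z = z} = (\<lambda>xs. (xs, k)) ` transversals R S"
  proof -
    have "swap_k (xs, i) = (xs, i) \<longleftrightarrow> i = k" if "(xs, i) \<in> P" for xs i
      using that length assms(2)
      by (auto simp: P_def Q_def transversals_def swap_k_def list_swap_eq_iff)
    then have "{z \<in> P. swap_k z = z} = {z \<in> P. snd z = k}" by auto
    also have "\<dots> = (\<lambda>xs. (xs, k)) ` transversals R S"
      using assms(2) by (force simp: P_def Q_def transversals_def)
    finally show ?thesis .
  qed
  also have "card \<dots> = card (transversals R S)" by (intro card_image inj_onI) simp
  finally show ?thesis using \<open>even (card P)\<close> by simp
qed

abbreviation alternate :: "'a \<Rightarrow> 'a \<Rightarrow> nat \<Rightarrow> 'a" where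
  "alternate x y i \<equiv> if even i then x else y"

definition rainbow_orders :: "('a \<Rightarrow> nat) \<Rightarrow> ('a \<Rightarrow> nat) \<Rightarrow> 'a set \<Rightarrow> 'a list set" where
  "rainbow_orders F G = transversals (\<lambda>i s. alternate F G i s = Suc i)"

context
  fixes F G :: "'a \<Rightarrow> nat" and S :: "'a set"
  assumes finite_S: "finite S"
    and colours: "\<And>s. s \<in> S \<Longrightarrow> F s \<in> {1..card S}" "\<And>s. s \<in> S \<Longrightarrow> G s \<in> {1..card S}"
    and eq_if_same_colour: "\<And>s s'. s \<in> S \<Longrightarrow> s' \<in> S \<Longrightarrow> F s = G s' \<Longrightarrow> s = s'"
begin

lemma parity_if_colours_differ:
  assumes "xs \<in> rainbow_orders F G S" "s \<in> S" "F s \<noteq> G s"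
  shows "odd (F s)" "even (G s)"
proof -
  have nth: "xs ! i \<in> S" "alternate F G i (xs ! i) = Suc i" if "i < card S" for i
    using assms(1) that by (auto simp: rainbow_orders_def transversals_def distinct_card)
  show "odd (F s)"
  proof
    assume "even (F s)"
    moreover obtain i where i: "F s = Suc i" "i < card S"
      using colours(1)[OF assms(2)] by (cases "F s") auto
    ultimately have "F s = G (xs ! i)" using nth(2)[of i] by simp
    then show False using eq_if_same_colour[OF assms(2) nth(1)[OF i(2)]] assms(3) by metis
  qed
  show "even (G s)"
  proof (rule ccontr)
    assume "odd (G s)"
    moreover obtain i where i: "G s = Suc i" "i < card S"
      using colours(2)[OF assms(2)] by (cases "G s") auto
    ultimately have "F (xs ! i) = G s" using nth(2)[of i] by simp
    then show False using eq_if_same_colour[OF nth(1)[OF i(2)] assms(2)] assms(3) by metis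
  qed
qed

lemma colours_differ_at_free_position:
  assumes xs: "xs \<in> transversals (\<lambda>i s. i \<noteq> k \<longrightarrow> alternate F G i s = Suc i) S"
    and s: "s \<in> S" "F s = Suc k" "F s \<noteq> G s"
  shows "F (xs ! k) \<noteq> G (xs ! k)"
proof
  have k: "k < card S" using colours(1)[OF s(1)] s(2) by simp
  have nth: "xs ! i \<in> S" if "i < card S" for i
    using xs that by (auto simp: transversals_def distinct_card)
  assume eq: "F (xs ! k) = G (xs ! k)"
  obtain i where i: "F (xs ! k) = Suc i" "i < card S"
    using colours(1)[OF nth[OF k]] by (cases "F (xs ! k)") auto
  show False
  proof (cases "i = k")
    case True
    then have "s = xs ! k" using eq_if_same_colour s nth[OF k] i(1) eq by metis
    then show False using eq s(3) by metis
  next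
    case False
    then have "alternate F G i (xs ! i) = Suc i" using xs i(2) by (simp add: transversals_def)
    then have "F (xs ! i) = G (xs ! k) \<or> F (xs ! k) = G (xs ! i)"
      using i(1) eq by (auto split: if_splits)
    then have "xs ! i = xs ! k" using eq_if_same_colour nth i(2) k by metis
    then show False
      using xs i(2) k False by (auto simp: transversals_def distinct_card nth_eq_iff_index_eq)
  qed
qed

lemma eq_if_odd_card_rainbow_orders:
  assumes odd: "odd (card (rainbow_orders F G S))" and "s \<in> S"
  shows "F s = G s"
proof (rule ccontr)
  assume neq: "F s \<noteq> G s"
  obtain xs where xs: "xs \<in> rainbow_orders F G S"
    using odd by (metis card.empty dvd_0_right equals0I)
  obtain k where k: "F s = Suc k" "k < card S"
    using colours(1)[OF \<open>s \<in> S\<close>] by (cases "F s") auto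
  have "even (card (rainbow_orders F G S))"
    unfolding rainbow_orders_def
  proof (rule even_card_transversals[OF finite_S k(2)])
    fix ys assume ys: "ys \<in> transversals (\<lambda>i s. i \<noteq> k \<longrightarrow> alternate F G i s = Suc i) S"
    define u where "u = ys ! k"
    have u: "u \<in> S" "F u \<noteq> G u"
      using ys k(2) colours_differ_at_free_position[OF ys \<open>s \<in> S\<close> k(1) neq]
      by (auto simp: u_def transversals_def distinct_card)
    have "{i. i < card S \<and> alternate F G i u = Suc i} = {F u - 1, G u - 1}"
      using parity_if_colours_differ[OF xs u] colours[OF u(1)] by (auto split: if_splits)
    moreover have "F u - 1 \<noteq> G u - 1"
      using u(2) colours[OF u(1)] by (auto simp: eq_diff_iff)
    ultimately show "even (card {i. i < card S \<and> alternate F G i (ys ! k) = Suc i})"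
      by (simp add: u_def)
  qed
  then show False using odd by contradiction
qed

end

section \<open>Ky Fan's lemma\<close>

abbreviation negate :: "'a \<times> bool \<Rightarrow> 'a \<times> bool" where
  "negate \<equiv> apsnd Not"

lemma negate_negate [simp]: "negate (negate z) = z"
  by (cases z) simp

definition signed_sets :: "nat \<Rightarrow> (nat \<times> bool) set set" where
  "signed_sets n = {x. inj_on fst x \<and> fst ` x \<subseteq> {1..n}}"

lemma finite_signed_set: "x \<in> signed_sets n \<Longrightarrow> finite x"
  using finite_imageD[of fst x] finite_subset[of "fst ` x" "{1..n}"] by (simp add: signed_sets_def)

text \<open>A list stands for the maximal flag of signed sets formed by its nonempty prefixes.\<close>
definition signed_flags :: "nat \<Rightarrow> (nat \<times> bool) list set" where
  "signed_flags n = {xs. distinct (map fst xs) \<and> fst ` set xs = {1..n}}"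

definition antipodal :: "((nat \<times> bool) set \<Rightarrow> bool) \<Rightarrow> nat \<Rightarrow> bool" where
  "antipodal \<sigma> n \<longleftrightarrow> (\<forall>x \<in> signed_sets n. x \<noteq> {} \<longrightarrow> \<sigma> (negate ` x) = (\<not> \<sigma> x))"

definition alternates_at :: "((nat \<times> bool) set \<Rightarrow> bool) \<Rightarrow> (nat \<times> bool) list \<Rightarrow> nat \<Rightarrow> bool" where
  "alternates_at \<sigma> xs i \<longleftrightarrow> \<sigma> (set (take (Suc i) xs)) = even i"

definition alternating_flags :: "((nat \<times> bool) set \<Rightarrow> bool) \<Rightarrow> nat \<Rightarrow> (nat \<times> bool) list set" where
  "alternating_flags \<sigma> n = {xs \<in> signed_flags n. \<forall>i<n. alternates_at \<sigma> xs i}"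

lemma length_signed_flag:
  assumes "xs \<in> signed_flags n"
  shows "length xs = n"
proof -
  have "length xs = card (fst ` set xs)"
    using assms distinct_card[of "map fst xs"] by (simp add: signed_flags_def)
  then show ?thesis using assms by (simp add: signed_flags_def)
qed

lemma finite_signed_flags: "finite (signed_flags n)"
proof (rule finite_subset)
  show "signed_flags n \<subseteq> {xs. set xs \<subseteq> {1..n} \<times> UNIV \<and> length xs = n}"
    using length_signed_flag by (force simp: signed_flags_def)
qed (simp add: finite_lists_length_eq)

lemma set_take_signed_flag:
  assumes "xs \<in> signed_flags n"
  shows "set (take i xs) \<in> signed_sets n"
  using assms set_take_subset[of i xs]
  by (auto simp: signed_flags_def signed_sets_def distinct_map intro: inj_on_subset)

lemma signed_flag_mem_iff:
  assumes "xs \<in> signed_flags n" "a \<in> {1..n}"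
  shows "(a, \<not> b) \<in> set xs \<longleftrightarrow> (a, b) \<notin> set xs"
proof
  assume "(a, \<not> b) \<in> set xs"
  then show "(a, b) \<notin> set xs"
    using assms(1) inj_onD[of fst "set xs" "(a, b)" "(a, \<not> b)"]
    by (auto simp: signed_flags_def distinct_map)
next
  assume "(a, b) \<notin> set xs"
  moreover have "a \<in> fst ` set xs" using assms by (simp add: signed_flags_def)
  then obtain c where "(a, c) \<in> set xs" by force
  ultimately show "(a, \<not> b) \<in> set xs" by (cases "c = b") auto
qed

lemma map_negate_signed_flag:
  assumes "xs \<in> signed_flags n"
  shows "map negate xs \<in> signed_flags n"
  using assms by (auto simp: signed_flags_def image_image comp_def)

lemma mem_negate_image_iff: "(a, b) \<in> negate ` x \<longleftrightarrow> (a, \<not> b) \<in> x"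
proof
  assume "(a, \<not> b) \<in> x"
  then have "negate (a, \<not> b) \<in> negate ` x" by (rule imageI)
  then show "(a, b) \<in> negate ` x" by simp
qed auto

lemma alternates_at_map_negate:
  assumes "antipodal \<sigma> n" "xs \<in> signed_flags n" "i < n"
  shows "alternates_at \<sigma> (map negate xs) i \<longleftrightarrow> \<not> alternates_at \<sigma> xs i"
proof -
  have "set (take (Suc i) xs) \<noteq> {}" using length_signed_flag[OF assms(2)] assms(3) by auto
  then show ?thesis
    using assms(1) set_take_signed_flag[OF assms(2)]
    by (auto simp: antipodal_def alternates_at_def take_map)
qed

definition upper_flags :: "nat \<Rightarrow> (nat \<times> bool) list set" where
  "upper_flags n = {xs \<in> signed_flags (Suc n). (Suc n, True) \<in> set xs}"

lemma length_upper_flag: "xs \<in> upper_flags n \<Longrightarrow> length xs = Suc n"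
  by (simp add: upper_flags_def length_signed_flag)

lemma card_alternating_flags_Suc:
  assumes "antipodal \<sigma> (Suc n)"
  shows "card (alternating_flags \<sigma> (Suc n)) = card {xs \<in> upper_flags n.
    (\<forall>i\<le>n. alternates_at \<sigma> xs i) \<or> (\<forall>i\<le>n. \<not> alternates_at \<sigma> xs i)}"
    (is "_ = card ?U")
proof (rule bij_betw_same_card)
  define to_upper where
    "to_upper xs = (if (Suc n, True) \<in> set xs then xs else map negate xs)" for xs
  define from_upper where
    "from_upper xs = (if \<forall>i\<le>n. alternates_at \<sigma> xs i then xs else map negate xs)" for xs
  note negate_facts = map_negate_signed_flag alternates_at_map_negate[OF assms] mem_negate_image_iff
    signed_flag_mem_iff[where a = "Suc n" and b = True and n = "Suc n", simplified]
  show "bij_betw to_upper (alternating_flags \<sigma> (Suc n)) ?U"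
  proof (rule bij_betw_byWitness[where f' = from_upper])
    show "\<forall>xs\<in>alternating_flags \<sigma> (Suc n). from_upper (to_upper xs) = xs"
      by (auto simp: to_upper_def from_upper_def alternating_flags_def less_Suc_eq_le negate_facts
          comp_def)
    show "\<forall>xs\<in>?U. to_upper (from_upper xs) = xs"
      by (auto simp: to_upper_def from_upper_def upper_flags_def negate_facts comp_def)
    show "to_upper ` alternating_flags \<sigma> (Suc n) \<subseteq> ?U"
      by (auto simp: to_upper_def alternating_flags_def upper_flags_def less_Suc_eq_le negate_facts)
    show "from_upper ` ?U \<subseteq> alternating_flags \<sigma> (Suc n)"
      by (auto simp: from_upper_def alternating_flags_def upper_flags_def less_Suc_eq_le
          negate_facts)
  qed
qed

text \<open>The other upper flag with the same members except the \<open>i\<close>-th, if there is one.\<close>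
definition exchange :: "nat \<Rightarrow> nat \<Rightarrow> (nat \<times> bool) list \<Rightarrow> (nat \<times> bool) list" where
  "exchange n i xs = (if i < n then list_swap i (Suc i) xs
     else if fst (xs ! n) = Suc n then xs else xs[n := negate (xs ! n)])"

lemma exchange_upper_flag:
  assumes "xs \<in> upper_flags n"
  shows "exchange n i xs \<in> upper_flags n"
proof -
  have xs: "xs \<in> signed_flags (Suc n)" "(Suc n, True) \<in> set xs" "length xs = Suc n"
    using assms length_upper_flag by (auto simp: upper_flags_def)
  have "map fst (exchange n i xs) =
      (if i < n then list_swap i (Suc i) (map fst xs) else map fst xs)"
    using xs(3) by (simp add: exchange_def map_list_swap map_update list_update_same_conv)
  then have "distinct (map fst (exchange n i xs))"
    "set (map fst (exchange n i xs)) = set (map fst xs)"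
    using xs(1,3) by (auto simp: signed_flags_def simp del: set_map)
  then have "exchange n i xs \<in> signed_flags (Suc n)"
    using xs(1) by (simp add: signed_flags_def)
  moreover have "(Suc n, True) \<in> set (exchange n i xs)"
  proof -
    obtain l where l: "l < Suc n" "xs ! l = (Suc n, True)"
      using xs(2,3) by (auto simp: in_set_conv_nth)
    show ?thesis
    proof (cases "i < n")
      case True
      then show ?thesis using xs(2,3) by (simp add: exchange_def)
    next
      case False
      then have "fst (xs ! n) = Suc n \<or> l \<noteq> n" using l by auto
      then have "exchange n i xs ! l = (Suc n, True)" using False l by (auto simp: exchange_def)
      then show ?thesis
        using l xs(3) by (metis exchange_def length_list_swap length_list_update nth_mem)
    qed
  qed
  ultimately show ?thesis by (simp add: upper_flags_def)
qed

lemma exchange_exchange: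
  assumes "xs \<in> upper_flags n"
  shows "exchange n i (exchange n i xs) = xs"
  using length_upper_flag[OF assms] by (auto simp: exchange_def)

lemma exchange_eq_iff:
  assumes "xs \<in> upper_flags n"
  shows "exchange n i xs = xs \<longleftrightarrow> n \<le> i \<and> xs ! n = (Suc n, True)"
proof -
  have xs: "xs \<in> signed_flags (Suc n)" "(Suc n, True) \<in> set xs" "length xs = Suc n" "distinct xs"
    using assms length_upper_flag by (auto simp: upper_flags_def signed_flags_def distinct_map)
  have "(Suc n, False) \<notin> set xs" using signed_flag_mem_iff[OF xs(1), of "Suc n" True] xs(2) by simp
  then have "fst (xs ! n) = Suc n \<longleftrightarrow> xs ! n = (Suc n, True)"
    using xs(3) by (metis (full_types) fst_conv lessI nth_mem surjective_pairing)
  moreover have "xs[n := negate (xs ! n)] \<noteq> xs"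
  proof
    assume "xs[n := negate (xs ! n)] = xs"
    then have "negate (xs ! n) = xs ! n" using xs(3) by (metis lessI nth_list_update_eq)
    then show False by (cases "xs ! n") simp
  qed
  ultimately show ?thesis using xs(3,4) by (auto simp: exchange_def list_swap_eq_iff)
qed

lemma alternates_at_exchange:
  assumes "xs \<in> upper_flags n" "i \<le> n" "j \<le> n" "j \<noteq> i"
  shows "alternates_at \<sigma> (exchange n i xs) j \<longleftrightarrow> alternates_at \<sigma> xs j"
proof -
  have "set (take (Suc j) (exchange n i xs)) = set (take (Suc j) xs)"
    using assms length_upper_flag[OF assms(1)] by (auto simp: exchange_def set_take_list_swap_Suc)
  then show ?thesis by (simp add: alternates_at_def)
qed

lemma upper_flag_snoc_iff: "ys @ [(Suc n, True)] \<in> upper_flags n \<longleftrightarrow> ys \<in> signed_flags n"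
proof -
  have "Suc n \<notin> X \<and> insert (Suc n) X = insert (Suc n) {1..n} \<longleftrightarrow> X = {1..n}" for X
    using insert_ident[of "Suc n" X "{1..n}"] by auto
  then show ?thesis by (auto simp: upper_flags_def signed_flags_def atLeastAtMostSuc_conv)
qed

lemma alternates_at_snoc:
  "i < length ys \<Longrightarrow> alternates_at \<sigma> (ys @ zs) i \<longleftrightarrow> alternates_at \<sigma> ys i"
  by (simp add: alternates_at_def)

text \<open>Deleting the \<open>i\<close>-th member of the flag leaves a chain with signs \<open>+, -, +, \<dots>\<close>.\<close>
definition flawed_flags :: "((nat \<times> bool) set \<Rightarrow> bool) \<Rightarrow> nat \<Rightarrow> ((nat \<times> bool) list \<times> nat) set" where
  "flawed_flags \<sigma> n = (SIGMA xs:upper_flags n. {i. switches_at (alternates_at \<sigma> xs) n i})"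

lemma finite_upper_flags: "finite (upper_flags n)"
  using finite_signed_flags by (simp add: upper_flags_def)

lemma finite_switches_at: "finite {i. switches_at t n i}"
  by (rule finite_subset[of _ "{..n}"]) (auto simp: switches_at_def)

lemma even_card_flawed_flags_iff_Suc:
  assumes "antipodal \<sigma> (Suc n)"
  shows "even (card (flawed_flags \<sigma> n)) \<longleftrightarrow> even (card (alternating_flags \<sigma> (Suc n)))"
  unfolding flawed_flags_def card_alternating_flags_Suc[OF assms]
  by (subst even_card_Sigma_iff)
    (simp_all add: finite_upper_flags finite_switches_at odd_card_switches_at)

lemma exchange_fixed_flawed_flags:
  "{(xs, i) \<in> flawed_flags \<sigma> n. exchange n i xs = xs} =
    (\<lambda>ys. (ys @ [(Suc n, True)], n)) ` alternating_flags \<sigma> n"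
proof (intro equalityI subsetI)
  fix z assume z: "z \<in> {(xs, i) \<in> flawed_flags \<sigma> n. exchange n i xs = xs}"
  obtain xs i where z_eq: "z = (xs, i)" by (cases z)
  then have xs: "xs \<in> upper_flags n" "xs ! n = (Suc n, True)" "i = n"
    "\<And>j. j < n \<Longrightarrow> alternates_at \<sigma> xs j"
    using z by (auto simp: flawed_flags_def switches_at_def exchange_eq_iff)
  have snoc: "xs = take n xs @ [(Suc n, True)]"
    using xs(2) length_upper_flag[OF xs(1)]
    by (metis lessI order_refl take_Suc_conv_app_nth take_all)
  then have "take n xs \<in> alternating_flags \<sigma> n"
    using xs(1,4) length_upper_flag[OF xs(1)] upper_flag_snoc_iff[of "take n xs" n]
    by (auto simp: alternating_flags_def alternates_at_def min_def)
  then show "z \<in> (\<lambda>ys. (ys @ [(Suc n, True)], n)) ` alternating_flags \<sigma> n"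
    using z_eq xs(3) snoc by auto
next
  fix z assume "z \<in> (\<lambda>ys. (ys @ [(Suc n, True)], n)) ` alternating_flags \<sigma> n"
  then obtain ys where ys: "z = (ys @ [(Suc n, True)], n)" "ys \<in> signed_flags n"
    "\<And>i. i < n \<Longrightarrow> alternates_at \<sigma> ys i"
    by (auto simp: alternating_flags_def)
  moreover have "ys @ [(Suc n, True)] \<in> upper_flags n" using ys(2) upper_flag_snoc_iff by simp
  ultimately show "z \<in> {(xs, i) \<in> flawed_flags \<sigma> n. exchange n i xs = xs}"
    using length_signed_flag[OF ys(2)]
    by (auto simp: flawed_flags_def switches_at_def exchange_eq_iff alternates_at_snoc)
qed

lemma even_card_flawed_flags_iff:
  "even (card (flawed_flags \<sigma> n)) \<longleftrightarrow> even (card (alternating_flags \<sigma> n))"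
proof -
  define exchange_flaw where "exchange_flaw = (\<lambda>(xs, i). (exchange n i xs, i))"
  have "even (card (flawed_flags \<sigma> n)) \<longleftrightarrow> even (card {z \<in> flawed_flags \<sigma> n. exchange_flaw z = z})"
  proof (rule even_card_iff_even_card_fixpoints)
    show "finite (flawed_flags \<sigma> n)"
      using finite_upper_flags finite_switches_at by (simp add: flawed_flags_def)
    show "exchange_flaw z \<in> flawed_flags \<sigma> n" if "z \<in> flawed_flags \<sigma> n" for z
      using that
      by (auto simp: exchange_flaw_def flawed_flags_def switches_at_def exchange_upper_flag
          alternates_at_exchange)
    show "exchange_flaw (exchange_flaw z) = z" if "z \<in> flawed_flags \<sigma> n" for z
      using that by (auto simp: exchange_flaw_def flawed_flags_def exchange_exchange)
  qed
  also have "{z \<in> flawed_flags \<sigma> n. exchange_flaw z = z} =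
      {(xs, i) \<in> flawed_flags \<sigma> n. exchange n i xs = xs}"
    by (auto simp: exchange_flaw_def)
  also have "card \<dots> = card (alternating_flags \<sigma> n)"
    unfolding exchange_fixed_flawed_flags by (intro card_image inj_onI) simp
  finally show ?thesis .
qed

text \<open>Ky Fan's lemma for labels with weakly increasing absolute values and no complementary pair:
  these alternate along a flag iff their signs do, so only signs need to be recorded.\<close>
theorem odd_card_alternating_flags:
  assumes "antipodal \<sigma> n"
  shows "odd (card (alternating_flags \<sigma> n))"
  using assms
proof (induction n)
  case 0
  have "alternating_flags \<sigma> 0 = {[]}" by (auto simp: alternating_flags_def signed_flags_def)
  then show ?case by simp
next
  case (Suc n)
  have "signed_sets n \<subseteq> signed_sets (Suc n)" by (auto simp: signed_sets_def)
  then have "antipodal \<sigma> n" using Suc.prems by (auto simp: antipodal_def)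
  then show ?case
    using Suc.IH even_card_flawed_flags_iff_Suc[OF Suc.prems] even_card_flawed_flags_iff by blast
qed

section \<open>Signs of signed sets\<close>

definition side :: "bool \<Rightarrow> ('a \<times> bool) set \<Rightarrow> 'a set" where
  "side b x = {a. (a, b) \<in> x}"

lemma side_empty [simp]: "side b {} = {}"
  by (simp add: side_def)

lemma side_insert [simp]:
  "side b (insert (a, b') x) = (if b = b' then insert a (side b x) else side b x)"
  by (auto simp: side_def)

lemma side_Un: "side b (x \<union> y) = side b x \<union> side b y"
  by (auto simp: side_def)

lemma side_negate: "side b (negate ` x) = side (\<not> b) x"
  by (simp add: side_def mem_negate_image_iff)

lemma side_subset: "side b x \<subseteq> fst ` x"
  by (auto simp: side_def intro: rev_image_eqI)

lemma finite_side: "finite x \<Longrightarrow> finite (side b x)"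
  by (rule finite_subset[OF side_subset finite_imageI])

lemma Un_sides: "side True x \<union> side False x = fst ` x"
proof
  show "fst ` x \<subseteq> side True x \<union> side False x"
  proof
    fix a assume "a \<in> fst ` x"
    then obtain b where "(a, b) \<in> x" by auto
    then show "a \<in> side True x \<union> side False x" by (cases b) (simp_all add: side_def)
  qed
qed (simp add: side_subset)

lemma disjoint_sides:
  assumes "inj_on fst x"
  shows "side b x \<inter> side (\<not> b) x = {}"
  using inj_onD[OF assms, of "(_, b)" "(_, \<not> b)"] by (auto simp: side_def)

definition min_sign :: "('a :: linorder \<times> bool) set \<Rightarrow> bool" where
  "min_sign x \<longleftrightarrow> (Min (fst ` x), True) \<in> x"

lemma min_sign_insert:
  assumes "finite x" "a \<notin> fst ` x" "x = {} \<or> min_sign (insert (a, b) x) \<noteq> min_sign x"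
  shows "min_sign (insert (a, b) x) = b"
proof (cases "x = {}")
  case False
  then have "Min (fst ` x) \<in> fst ` x" using assms(1) by simp
  then have "Min (fst ` x) \<noteq> a" using assms(2) by metis
  have min: "Min (fst ` insert (a, b) x) = min a (Min (fst ` x))" using False assms(1) by simp
  show ?thesis
  proof (cases "a < Min (fst ` x)")
    case True
    then show ?thesis using assms(2) min by (force simp: min_sign_def)
  next
    case False
    then have "min_sign (insert (a, b) x) = min_sign x"
      using min \<open>Min (fst ` x) \<noteq> a\<close> by (simp add: min_sign_def)
    then show ?thesis using assms(3) \<open>x \<noteq> {}\<close> by simp
  qed
qed (simp add: min_sign_def)

lemma min_sign_negate:
  assumes "finite x" "x \<noteq> {}" "inj_on fst x"
  shows "min_sign (negate ` x) = (\<not> min_sign x)"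
proof -
  define a where "a = Min (fst ` x)"
  have "a \<in> side True x \<union> side False x" using assms(1,2) by (simp add: a_def Un_sides)
  then have "a \<in> side False x \<longleftrightarrow> a \<notin> side True x" using disjoint_sides[OF assms(3), of True] by auto
  moreover have "fst ` negate ` x = fst ` x" by (simp add: image_image)
  then have "min_sign (negate ` x) \<longleftrightarrow> a \<in> side True (negate ` x)"
    by (simp add: min_sign_def a_def side_def)
  then have "min_sign (negate ` x) \<longleftrightarrow> a \<in> side False x" by (simp add: side_negate)
  moreover have "min_sign x \<longleftrightarrow> a \<in> side True x" by (simp add: min_sign_def a_def side_def)
  ultimately show ?thesis by simp
qed

lemma nth_fresh_signed_flag:
  assumes "xs \<in> signed_flags n" "i < n"
  shows "fst (xs ! i) \<notin> fst ` set (take i xs)"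
proof
  have xs: "distinct (map fst xs)" "length xs = n"
    using assms length_signed_flag by (auto simp: signed_flags_def)
  assume "fst (xs ! i) \<in> fst ` set (take i xs)"
  then obtain j where "j < i" "fst (xs ! i) = fst (xs ! j)"
    using assms(2) xs(2) by (auto simp: in_set_conv_nth)
  then show False using xs assms(2) nth_eq_iff_index_eq[of "map fst xs" i j] by simp
qed

lemma set_take_Suc_nth:
  assumes "i < length xs"
  shows "set (take (Suc i) xs) = insert (xs ! i) (set (take i xs))"
  using assms by (simp add: take_Suc_conv_app_nth)

lemma card_Diff_prefix:
  assumes "xs \<in> signed_flags n" "i \<le> n"
  shows "card ({1..n} - fst ` set (take i xs)) = n - i"
proof -
  have "distinct (map fst (take i xs))"
    using assms(1) by (simp add: signed_flags_def flip: take_map)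
  then have "card (fst ` set (take i xs)) = i"
    using distinct_card[of "map fst (take i xs)"] length_signed_flag[OF assms(1)] assms(2) by simp
  then show ?thesis
    using set_take_signed_flag[OF assms(1), of i] by (simp add: card_Diff_subset signed_sets_def)
qed

lemma card_side_take:
  assumes "xs \<in> signed_flags n" "\<forall>i<n. snd (xs ! i) = even i" "i \<le> n"
  shows "card (side b (set (take i xs))) = (i + of_bool b) div 2"
  using assms(3)
proof (induction i)
  case (Suc i)
  obtain a where a: "xs ! i = (a, even i)"
    using assms(2)[rule_format, of i] Suc.prems by (cases "xs ! i") auto
  have "a \<notin> side b (set (take i xs))"
    using nth_fresh_signed_flag[OF assms(1), of i] Suc.prems a side_subset by fastforce
  moreover have "finite (side b (set (take i xs)))" by (simp add: finite_side)
  ultimately have "card (side b (set (take (Suc i) xs))) =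
      card (side b (set (take i xs))) + of_bool (b = even i)"
    using set_take_Suc_nth[of i xs] a Suc.prems length_signed_flag[OF assms(1)] by auto
  also have "\<dots> = (Suc i + of_bool b) div 2"
    using Suc by (cases "even i"; cases b) (auto elim!: evenE oddE)
  finally show ?case .
qed (simp add: of_bool_def)

section \<open>Colourings of Kneser graphs\<close>

definition top_colour :: "('a set \<Rightarrow> nat) \<Rightarrow> nat \<Rightarrow> 'a set \<Rightarrow> nat" where
  "top_colour c k X = Max (insert 0 (c ` {Y. Y \<subseteq> X \<and> card Y = k}))"

lemma top_colour_mono:
  assumes "finite X'" "X \<subseteq> X'"
  shows "top_colour c k X \<le> top_colour c k X'"
  unfolding top_colour_def using assms by (intro Max_mono) auto

lemma top_colour_ge:
  assumes "finite X" "Y \<subseteq> X" "card Y = k"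
  shows "c Y \<le> top_colour c k X"
  using assms unfolding top_colour_def by (intro Max_ge) auto

lemma top_colour_attained:
  assumes "finite X" "top_colour c k X \<noteq> 0"
  obtains Y where "Y \<subseteq> X" "card Y = k" "c Y = top_colour c k X"
proof -
  have "top_colour c k X \<in> insert 0 (c ` {Y. Y \<subseteq> X \<and> card Y = k})"
    unfolding top_colour_def using assms by (intro Max_in) auto
  then show ?thesis using assms(2) that by auto
qed

lemma top_colour_eq_0:
  assumes "finite X" "card X < k"
  shows "top_colour c k X = 0"
proof (rule ccontr)
  assume "top_colour c k X \<noteq> 0"
  then obtain Y where "Y \<subseteq> X" "card Y = k" using assms(1) by (auto elim: top_colour_attained)
  then show False using assms card_mono[of X Y] by simp
qed

lemma top_colour_eq_colour:
  assumes "finite X" "card X = k"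
  shows "top_colour c k X = c X"
proof -
  have "{Y. Y \<subseteq> X \<and> card Y = k} = {X}" using assms card_subset_eq by auto
  then show ?thesis by (simp add: top_colour_def)
qed

text \<open>If \<open>c\<close> is a proper colouring with positive colours, a tie between disjoint sides means that
  neither contains a \<open>k\<close>-set.\<close>
definition colour_sign ::
    "('a :: linorder set \<Rightarrow> nat) \<Rightarrow> nat \<Rightarrow> ('a \<times> bool) set \<Rightarrow> bool" where
  "colour_sign c k x =
    (if top_colour c k (side True x) = top_colour c k (side False x) then min_sign x
     else top_colour c k (side False x) < top_colour c k (side True x))"

lemma antipodal_colour_sign: "antipodal (colour_sign c k) n"
  unfolding antipodal_def
proof (intro ballI impI)
  fix x assume x: "x \<in> signed_sets n" "x \<noteq> {}"
  then have "min_sign (negate ` x) = (\<not> min_sign x)"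
    using finite_signed_set by (intro min_sign_negate) (auto simp: signed_sets_def)
  then show "colour_sign c k (negate ` x) = (\<not> colour_sign c k x)"
    by (auto simp: colour_sign_def side_negate)
qed

lemma colour_sign_insert:
  assumes "finite x" "a \<notin> fst ` x" "x = {} \<or> colour_sign c k (insert (a, b) x) \<noteq> colour_sign c k x"
  shows "colour_sign c k (insert (a, b) x) = b"
proof -
  have "top_colour c k (side b x) \<le> top_colour c k (insert a (side b x))"
    using assms(1) by (intro top_colour_mono) (auto simp: finite_side)
  then show ?thesis
    using min_sign_insert[OF assms(1,2), of b] assms(3)
    by (cases b) (auto simp: colour_sign_def split: if_splits)
qed

lemma snd_nth_alternating_flag:
  assumes "xs \<in> alternating_flags (colour_sign c k) n" "i < n"
  shows "snd (xs ! i) = even i"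
proof -
  have xs: "xs \<in> signed_flags n"
    and sign: "\<And>j. j < n \<Longrightarrow> colour_sign c k (set (take (Suc j) xs)) = even j"
    using assms(1) by (auto simp: alternating_flags_def alternates_at_def)
  obtain a b where ab: "xs ! i = (a, b)" by (cases "xs ! i")
  have insert: "set (take (Suc i) xs) = insert (a, b) (set (take i xs))"
    using set_take_Suc_nth[of i xs] assms(2) length_signed_flag[OF xs] ab by simp
  have "set (take i xs) = {} \<or>
      colour_sign c k (set (take (Suc i) xs)) \<noteq> colour_sign c k (set (take i xs))"
  proof (cases i)
    case (Suc j)
    then show ?thesis using sign[OF assms(2)] sign[of j] assms(2) by simp
  qed simp
  moreover have "a \<notin> fst ` set (take i xs)" using nth_fresh_signed_flag[OF xs assms(2)] ab by simp
  ultimately have "colour_sign c k (set (take (Suc i) xs)) = b"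
    unfolding insert by (intro colour_sign_insert) simp_all
  then show ?thesis using sign[OF assms(2)] ab by simp
qed

lemma all_less_add_iff:
  fixes a b :: nat
  shows "(\<forall>i<a+b. P i) \<longleftrightarrow> (\<forall>i<a. P i) \<and> (\<forall>i<b. P (a + i))"
proof (intro iffI allI impI)
  fix i assume "(\<forall>i<a. P i) \<and> (\<forall>i<b. P (a + i))" "i < a + b"
  then show "P i" by (cases "i < a") (auto simp: not_less dest!: le_Suc_ex)
qed simp

lemma strictly_increasing_iff_eq_Suc:
  fixes v :: "nat \<Rightarrow> nat"
  assumes "\<And>i. i < t \<Longrightarrow> v i \<le> t"
  shows "(\<forall>i<t. (if i = 0 then 0 else v (i - 1)) < v i) \<longleftrightarrow> (\<forall>i<t. v i = Suc i)"
proof (intro iffI allI impI)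
  assume incr: "\<forall>i<t. (if i = 0 then 0 else v (i - 1)) < v i"
  have lower: "Suc i \<le> v i" if "i < t" for i
    using that by (induction i) (use incr in fastforce)+
  fix i assume "i < t"
  then have "i \<le> t - 1" by simp
  then have "v i \<le> Suc i"
  proof (induction rule: inc_induct)
    case base
    then show ?case using assms[of "t - 1"] \<open>i < t\<close> by simp
  next
    case (step j)
    then have "v j < v (Suc j)" using incr[rule_format, of "Suc j"] by simp
    then show ?case using step.IH by simp
  qed
  then show "v i = Suc i" using lower[OF \<open>i < t\<close>] by simp
qed auto

locale kneser_colouring =
  fixes m t :: nat and c :: "nat set \<Rightarrow> nat"
  assumes colour_range: "Y \<in> kneser_vertices (2*m+t) (Suc m) \<Longrightarrow> c Y \<in> {1..t}"
    and colour_neq: "Y \<in> kneser_vertices (2*m+t) (Suc m) \<Longrightarrow> Z \<in> kneser_vertices (2*m+t) (Suc m) \<Longrightarrow>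
      kneser_adj Y Z \<Longrightarrow> c Y \<noteq> c Z"
begin

abbreviation top_col :: "nat set \<Rightarrow> nat" where
  "top_col \<equiv> top_colour c (Suc m)"

abbreviation sign :: "(nat \<times> bool) set \<Rightarrow> bool" where
  "sign \<equiv> colour_sign c (Suc m)"

lemma top_col_pos:
  assumes "X \<subseteq> {1..2*m+t}" "m < card X"
  shows "0 < top_col X"
proof -
  obtain Y where Y: "Y \<subseteq> X" "card Y = Suc m"
    using assms(2) obtain_subset_with_card_n Suc_leI by metis
  then have "Y \<in> kneser_vertices (2*m+t) (Suc m)" using assms(1) by (simp add: kneser_vertices_def)
  then have "0 < c Y" using colour_range by force
  also have "c Y \<le> top_col X" using Y assms finite_subset by (intro top_colour_ge) auto
  finally show ?thesis .
qed

lemma top_col_le: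
  assumes "X \<subseteq> {1..2*m+t}"
  shows "top_col X \<le> t"
proof (cases "top_col X = 0")
  case False
  then obtain Y where "Y \<subseteq> X" "card Y = Suc m" "c Y = top_col X"
    using finite_subset[OF assms] by (auto elim: top_colour_attained)
  then show ?thesis using colour_range[of Y] assms by (auto simp: kneser_vertices_def)
qed simp

lemma top_col_neq:
  assumes "X \<subseteq> {1..2*m+t}" "X' \<subseteq> {1..2*m+t}" "X \<inter> X' = {}" "top_col X \<noteq> 0"
  shows "top_col X \<noteq> top_col X'"
proof
  assume eq: "top_col X = top_col X'"
  have "finite X" "finite X'" using assms(1,2) finite_subset by auto
  obtain Y where Y: "Y \<subseteq> X" "card Y = Suc m" "c Y = top_col X"
    using top_colour_attained[OF \<open>finite X\<close> assms(4)] .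
  obtain Z where Z: "Z \<subseteq> X'" "card Z = Suc m" "c Z = top_col X'"
    using top_colour_attained[OF \<open>finite X'\<close>] assms(4) eq by metis
  have "Y \<in> kneser_vertices (2*m+t) (Suc m)" "Z \<in> kneser_vertices (2*m+t) (Suc m)" "kneser_adj Y Z"
    using Y Z assms by (auto simp: kneser_vertices_def kneser_adj_def)
  then show False using colour_neq Y Z eq by metis
qed

definition leading_colour :: "(nat \<times> bool) list \<Rightarrow> nat \<Rightarrow> nat" where
  "leading_colour xs i = top_col (side (even i) (set (take (Suc (2*m+i)) xs)))"

lemma side_take_subset:
  assumes "xs \<in> signed_flags n"
  shows "side b (set (take i xs)) \<subseteq> {1..n}"
  using side_subset[of b "set (take i xs)"] set_take_signed_flag[OF assms, of i]
  by (auto simp: signed_sets_def)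

lemma alternates_at_iff_leading_colour:
  assumes xs: "xs \<in> signed_flags (2*m+t)" "\<forall>i<2*m+t. snd (xs ! i) = even i" and "i < t"
  shows "alternates_at sign xs (2*m+i) \<longleftrightarrow>
    (if i = 0 then 0 else leading_colour xs (i - 1)) < leading_colour xs i"
proof -
  let ?x = "set (take (Suc (2*m+i)) xs)"
  have card: "card (side b ?x) = (Suc (2*m+i) + of_bool b) div 2" for b
    using card_side_take[OF xs] \<open>i < t\<close> by simp
  have trailing: "top_col (side (odd i) ?x) = (if i = 0 then 0 else leading_colour xs (i - 1))"
  proof (cases i)
    case 0
    then show ?thesis using card[of False] by (simp add: top_colour_eq_0 finite_side)
  next
    case (Suc j)
    obtain a where "xs ! (2*m+i) = (a, even i)"
      using xs(2)[rule_format, of "2*m+i"] \<open>i < t\<close> by (cases "xs ! (2*m+i)") auto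
    then have "?x = insert (a, even i) (set (take (Suc (2*m+j)) xs))"
      using set_take_Suc_nth[of "2*m+i" xs] length_signed_flag[OF xs(1)] \<open>i < t\<close> Suc by simp
    then show ?thesis using Suc by (simp add: leading_colour_def)
  qed
  have "m < card (side (even i) ?x)" unfolding card by (cases "even i") (auto elim!: evenE oddE)
  then have "leading_colour xs i \<noteq> 0"
    using top_col_pos[OF side_take_subset[OF xs(1)]] by (simp add: leading_colour_def)
  moreover have "side (even i) ?x \<inter> side (odd i) ?x = {}"
    using disjoint_sides set_take_signed_flag[OF xs(1)] by (auto simp: signed_sets_def)
  ultimately have "leading_colour xs i \<noteq> top_col (side (odd i) ?x)"
    unfolding leading_colour_def using xs(1) by (intro top_col_neq side_take_subset) auto
  then have "alternates_at sign xs (2*m+i) \<longleftrightarrow> top_col (side (odd i) ?x) < leading_colour xs i"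
    by (cases "even i") (auto simp: alternates_at_def colour_sign_def leading_colour_def)
  then show ?thesis by (simp only: trailing)
qed

lemma alternating_flags_iff:
  "xs \<in> alternating_flags sign (2*m+t) \<longleftrightarrow>
    xs \<in> signed_flags (2*m+t) \<and> (\<forall>i<2*m+t. snd (xs ! i) = even i) \<and>
    (\<forall>i<2*m. alternates_at sign xs i) \<and> (\<forall>i<t. leading_colour xs i = Suc i)"
proof (cases "xs \<in> signed_flags (2*m+t) \<and> (\<forall>i<2*m+t. snd (xs ! i) = even i)")
  case True
  have "leading_colour xs i \<le> t" for i
    using True by (auto simp: leading_colour_def intro!: top_col_le side_take_subset)
  then have "(\<forall>i<t. alternates_at sign xs (2*m+i)) \<longleftrightarrow> (\<forall>i<t. leading_colour xs i = Suc i)"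
    using strictly_increasing_iff_eq_Suc[of t "leading_colour xs"]
      alternates_at_iff_leading_colour True by simp
  moreover have "(\<forall>i<2*m+t. alternates_at sign xs i) \<longleftrightarrow>
      (\<forall>i<2*m. alternates_at sign xs i) \<and> (\<forall>i<t. alternates_at sign xs (2*m+i))"
    by (rule all_less_add_iff)
  ultimately show ?thesis using True by (simp add: alternating_flags_def)
next
  case False
  then show ?thesis using snd_nth_alternating_flag by (auto simp: alternating_flags_def)
qed

text \<open>The orders in which an alternating flag through \<open>(A, B)\<close> can add the remaining elements, to
  the two sides in turn.\<close>
definition leading_orders :: "nat set \<Rightarrow> nat set \<Rightarrow> nat list set" where
  "leading_orders A B = {ss. distinct ss \<and> set ss = {1..2*m+t} - (A \<union> B) \<and>
     (\<forall>i<t. top_col (alternate A B i \<union> (!) ss ` {j. j \<le> i \<and> even j = even i}) = Suc i)}"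

lemma leading_colour_append:
  assumes "length p = 2*m" "length ss = t" "i < t"
  shows "leading_colour (p @ zip ss (map even [0..<t])) i =
    top_col (side (even i) (set p) \<union> (!) ss ` {j. j \<le> i \<and> even j = even i})"
proof -
  have "set (take (Suc i) (zip ss (map even [0..<t]))) = (\<lambda>j. (ss ! j, even j)) ` {..i}"
    using assms(2,3) by (subst nth_image[symmetric]) (auto intro!: image_cong)
  then have "side (even i) (set (take (Suc i) (zip ss (map even [0..<t])))) =
      (!) ss ` {j. j \<le> i \<and> even j = even i}"
    by (auto simp: side_def)
  moreover have "take (Suc (2*m+i)) (p @ zs) = p @ take (Suc i) zs" for zs
    using assms(1) by simp
  ultimately show ?thesis
    unfolding leading_colour_def by (simp only: set_append side_Un)
qed

lemma append_mem_alternating_flags_iff: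
  assumes xs: "xs \<in> alternating_flags sign (2*m+t)" and p: "p = take (2*m) xs" and "length ss = t"
  shows "p @ zip ss (map even [0..<t]) \<in> alternating_flags sign (2*m+t) \<longleftrightarrow>
    ss \<in> leading_orders (side True (set p)) (side False (set p))"
proof -
  let ?ys = "p @ zip ss (map even [0..<t])"
  have flag: "xs \<in> signed_flags (2*m+t)" "length xs = 2*m+t"
    using xs length_signed_flag by (auto simp: alternating_flags_iff)
  have len: "length p = 2*m" using p flag(2) by simp
  have dist: "distinct (map fst p)" and sub: "fst ` set p \<subseteq> {1..2*m+t}"
    using p flag(1) set_take_signed_flag[OF flag(1), of "2*m"]
    by (auto simp: signed_flags_def signed_sets_def simp flip: take_map)
  have "?ys \<in> signed_flags (2*m+t) \<longleftrightarrow> distinct ss \<and> set ss = {1..2*m+t} - fst ` set p"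
  proof -
    have "map fst ?ys = map fst p @ ss" using \<open>length ss = t\<close> by simp
    moreover have "fst ` set ?ys = set (map fst ?ys)" by (rule set_map[symmetric])
    ultimately show ?thesis
      using dist sub
      by (auto simp only: signed_flags_def mem_Collect_eq distinct_append set_append set_map)
  qed
  moreover have "snd (?ys ! i) = even i" if "i < 2*m+t" for i
    using that len xs p \<open>length ss = t\<close> by (auto simp: nth_append alternating_flags_iff)
  moreover have "alternates_at sign ?ys i" if "i < 2*m" for i
    using that len xs p
    by (simp add: alternates_at_snoc) (simp add: alternates_at_def alternating_flags_iff)
  moreover have "leading_colour ?ys i = top_col
      (alternate (side True (set p)) (side False (set p)) i \<union> (!) ss ` {j. j \<le> i \<and> even j = even i})"
    if "i < t" for i
    unfolding leading_colour_append[OF len \<open>length ss = t\<close> that] by simp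
  ultimately show ?thesis
    unfolding alternating_flags_iff leading_orders_def Un_sides by auto
qed

lemma card_alternating_fibre:
  assumes xs: "xs \<in> alternating_flags sign (2*m+t)" and p: "p = take (2*m) xs"
  shows "card {ys \<in> alternating_flags sign (2*m+t). take (2*m) ys = p} =
    card (leading_orders (side True (set p)) (side False (set p)))"
proof (rule bij_betw_same_card)
  let ?X = "{ys \<in> alternating_flags sign (2*m+t). take (2*m) ys = p}"
    and ?L = "leading_orders (side True (set p)) (side False (set p))"
  note mem_iff = append_mem_alternating_flags_iff[OF xs p]
  have len: "length ys = 2*m+t" if "ys \<in> alternating_flags sign (2*m+t)" for ys
    using that length_signed_flag by (auto simp: alternating_flags_def)
  then have len_p: "length p = 2*m" using xs p by simp
  have tail: "length ss = t" if "ss \<in> ?L" for ss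
    using that distinct_card[of ss] card_Diff_prefix[of xs "2*m+t" "2*m"] xs p
    by (auto simp: leading_orders_def Un_sides alternating_flags_def)
  have split: "p @ zip (map fst (drop (2*m) ys)) (map even [0..<t]) = ys" if "ys \<in> ?X" for ys
  proof -
    have "map snd (drop (2*m) ys) = map even [0..<t]"
      using that len by (intro nth_equalityI) (auto simp: alternating_flags_iff)
    then have "zip (map fst (drop (2*m) ys)) (map even [0..<t]) = drop (2*m) ys"
      by (metis zip_map_fst_snd)
    then show ?thesis using that append_take_drop_id[of "2*m" ys] by simp
  qed
  show "bij_betw (\<lambda>ys. map fst (drop (2*m) ys)) ?X ?L"
  proof (rule bij_betw_byWitness[where f' = "\<lambda>ss. p @ zip ss (map even [0..<t])"])
    show "\<forall>ys\<in>?X. p @ zip (map fst (drop (2*m) ys)) (map even [0..<t]) = ys" using split by blast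
    show "\<forall>ss\<in>?L. map fst (drop (2*m) (p @ zip ss (map even [0..<t]))) = ss"
      using len_p tail by simp
    show "(\<lambda>ys. map fst (drop (2*m) ys)) ` ?X \<subseteq> ?L"
    proof (intro image_subsetI)
      fix ys assume ys: "ys \<in> ?X"
      have "length (map fst (drop (2*m) ys)) = t" using len ys by simp
      from mem_iff[OF this] show "map fst (drop (2*m) ys) \<in> ?L"
        using ys unfolding split[OF ys] by simp
    qed
    show "(\<lambda>ss. p @ zip ss (map even [0..<t])) ` ?L \<subseteq> ?X"
      using mem_iff tail len_p by auto
  qed
qed

lemma obtain_odd_leading_orders:
  obtains A B where "A \<union> B \<subseteq> {1..2*m+t}" "A \<inter> B = {}" "card A = m" "card B = m"
    "odd (card (leading_orders A B))"
proof -
  let ?X = "alternating_flags sign (2*m+t)"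
  have "odd (card ?X)" by (intro odd_card_alternating_flags antipodal_colour_sign)
  moreover have "finite ?X" using finite_signed_flags by (simp add: alternating_flags_def)
  ultimately obtain p where "p \<in> take (2*m) ` ?X" "odd (card {ys \<in> ?X. take (2*m) ys = p})"
    using even_card_if_even_fibres[of ?X "take (2*m)"] by blast
  then obtain xs where xs: "xs \<in> ?X" "p = take (2*m) xs"
    and odd: "odd (card (leading_orders (side True (set p)) (side False (set p))))"
    using card_alternating_fibre by auto
  have flag: "xs \<in> signed_flags (2*m+t)" "\<forall>i<2*m+t. snd (xs ! i) = even i"
    using xs(1) by (simp_all add: alternating_flags_iff)
  then have "card (side b (set p)) = m" for b
    using card_side_take[OF flag, of "2*m" b] xs(2) by simp
  moreover have "side True (set p) \<union> side False (set p) \<subseteq> {1..2*m+t}"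
    using side_take_subset[OF flag(1)] xs(2) by simp
  moreover have "side True (set p) \<inter> side False (set p) = {}"
    using disjoint_sides[of "set p" True] set_take_signed_flag[OF flag(1)] xs(2)
    by (simp add: signed_sets_def)
  ultimately show ?thesis using that odd by blast
qed

end

section \<open>Colourings with four colours\<close>

lemma all_less_4: "(\<forall>i<4::nat. P i) \<longleftrightarrow> P 0 \<and> P 1 \<and> P 2 \<and> P 3"
  by (auto simp: less_Suc_eq numeral_eq_Suc)

locale kneser_four_colouring_pair = kneser_colouring m 4 c for m c +
  fixes A B :: "nat set"
  assumes Un_subset: "A \<union> B \<subseteq> {1..2*m+4}" and disjoint: "A \<inter> B = {}"
    and card_A: "card A = m" and card_B: "card B = m"
begin

definition rest :: "nat set" where
  "rest = {1..2*m+4} - (A \<union> B)"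

lemma finite_AB: "finite A" "finite B"
  using Un_subset finite_subset by blast+

lemma finite_rest: "finite rest"
  by (simp add: rest_def)

lemma card_rest: "card rest = 4"
proof -
  have "card (A \<union> B) = 2*m" using finite_AB disjoint card_A card_B by (simp add: card_Un_disjoint)
  then show ?thesis using Un_subset finite_AB by (simp add: rest_def card_Diff_subset)
qed

lemma vertices:
  assumes "s \<in> rest"
  shows "insert s A \<in> kneser_vertices (2*m+4) (Suc m)" "insert s B \<in> kneser_vertices (2*m+4) (Suc m)"
  using assms Un_subset finite_AB card_A card_B by (auto simp: kneser_vertices_def rest_def)

lemma adjacent:
  assumes "s \<in> rest" "s' \<in> rest" "s \<noteq> s'"
  shows "kneser_adj (insert s A) (insert s' B)"
  using assms disjoint by (auto simp: kneser_adj_def rest_def)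

abbreviation colour_A :: "nat \<Rightarrow> nat" where
  "colour_A s \<equiv> c (insert s A)"

abbreviation colour_B :: "nat \<Rightarrow> nat" where
  "colour_B s \<equiv> c (insert s B)"

lemma colours_range:
  assumes "s \<in> rest"
  shows "colour_A s \<in> {1..4}" "colour_B s \<in> {1..4}"
  by (intro colour_range vertices assms)+

lemma eq_if_colours_eq:
  assumes "s \<in> rest" "s' \<in> rest" "colour_A s = colour_B s'"
  shows "s = s'"
  using colour_neq[OF vertices(1)[OF assms(1)] vertices(2)[OF assms(2)] adjacent[OF assms(1,2)]]
    assms(3) by blast

lemma leading_orders_iff:
  "ss \<in> leading_orders A B \<longleftrightarrow> distinct ss \<and> set ss = rest \<and>
     colour_A (ss ! 0) = 1 \<and> colour_B (ss ! 1) = 2 \<and>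
     top_col (insert (ss ! 2) (insert (ss ! 0) A)) = 3 \<and>
     top_col (insert (ss ! 3) (insert (ss ! 1) B)) = 4"
proof (cases "distinct ss \<and> set ss = rest")
  case True
  then have mem: "ss ! i \<in> rest" if "i < 4" for i
    using that card_rest distinct_card[of ss] by (metis nth_mem)
  have idx: "{j. j \<le> 0 \<and> even j = even (0::nat)} = {0::nat}"
    "{j. j \<le> 1 \<and> even j = even (1::nat)} = {1::nat}"
    "{j. j \<le> 2 \<and> even j = even (2::nat)} = {0, 2::nat}"
    "{j. j \<le> 3 \<and> even j = even (3::nat)} = {1, 3::nat}"
    by (auto; presburger)+
  have top: "top_col (insert (ss ! 0) A) = colour_A (ss ! 0)"
    "top_col (insert (ss ! Suc 0) B) = colour_B (ss ! Suc 0)"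
    using vertices mem finite_AB by (auto simp: kneser_vertices_def intro!: top_colour_eq_colour)
  show ?thesis
    using True unfolding leading_orders_def mem_Collect_eq all_less_4 idx
    by (simp add: top rest_def insert_commute) (simp only: numeral_2_eq_2)
next
  case False
  then show ?thesis by (auto simp: leading_orders_def rest_def)
qed

lemma nth_order_of_rest:
  assumes "distinct ss" "set ss = rest"
  shows "length ss = 4" "ss ! 0 \<in> rest" "ss ! 1 \<in> rest" "ss ! 2 \<in> rest" "ss ! 3 \<in> rest"
  using assms distinct_card[of ss] card_rest by (auto simp flip: assms(2))

lemma third_and_fourth_colour_iff:
  assumes mem: "w \<in> rest" "x \<in> rest" "y \<in> rest" "z \<in> rest" and dist: "distinct [w, x, y, z]"
    and "colour_A w = 1" "colour_B x = 2"
  shows "colour_A y = 3 \<and> colour_B z = 4 \<longleftrightarrow>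
    top_col (insert y (insert w A)) = 3 \<and> top_col (insert z (insert x B)) = 4 \<and>
    colour_A y \<noteq> 1 \<and> colour_B z \<noteq> 2"
proof -
  let ?A = "insert y (insert w A)" and ?B = "insert z (insert x B)"
  have sub: "?A \<subseteq> {1..2*m+4}" "?B \<subseteq> {1..2*m+4}" "?A \<inter> ?B = {}"
    using mem dist Un_subset disjoint by (auto simp: rest_def)
  have lower: "colour_A y \<le> top_col ?A" "colour_B z \<le> top_col ?B"
    using vertices[OF mem(3)] vertices[OF mem(4)] finite_AB
    by (auto simp: kneser_vertices_def intro!: top_colour_ge)
  have upper: "top_col ?A \<le> 4" "top_col ?B \<le> 4" using sub top_col_le by blast+
  have pos: "1 \<le> colour_A y" "1 \<le> colour_B z"
    using colours_range(1)[OF mem(3)] colours_range(2)[OF mem(4)] by simp_all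
  have "top_col ?A \<noteq> top_col ?B" using lower pos by (intro top_col_neq sub) auto
  moreover have "colour_A y \<noteq> 2" "colour_B z \<noteq> 1" "colour_A y \<noteq> colour_B z"
    using eq_if_colours_eq[OF mem(3,2)] eq_if_colours_eq[OF mem(1,4)] eq_if_colours_eq[OF mem(3,4)]
      dist assms(6,7) by auto
  ultimately show ?thesis using lower upper pos by auto
qed

lemma rainbow_orders_iff:
  "ss \<in> rainbow_orders colour_A colour_B rest \<longleftrightarrow> distinct ss \<and> set ss = rest \<and>
     colour_A (ss ! 0) = 1 \<and> colour_B (ss ! 1) = 2 \<and> colour_A (ss ! 2) = 3 \<and> colour_B (ss ! 3) = 4"
  unfolding rainbow_orders_def transversals_def mem_Collect_eq card_rest all_less_4
  by simp (simp only: numeral_2_eq_2)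

lemma rainbow_orders_eq:
  "rainbow_orders colour_A colour_B rest =
    {ss \<in> leading_orders A B. colour_A (ss ! 2) \<noteq> 1 \<and> colour_B (ss ! 3) \<noteq> 2}"
proof (intro set_eqI)
  fix ss
  show "ss \<in> rainbow_orders colour_A colour_B rest \<longleftrightarrow>
      ss \<in> {ss \<in> leading_orders A B. colour_A (ss ! 2) \<noteq> 1 \<and> colour_B (ss ! 3) \<noteq> 2}"
  proof (cases "distinct ss \<and> set ss = rest \<and> colour_A (ss ! 0) = 1 \<and> colour_B (ss ! 1) = 2")
    case True
    then have "distinct [ss ! 0, ss ! 1, ss ! 2, ss ! 3]"
      using nth_order_of_rest(1) by (simp add: nth_eq_iff_index_eq)
    then show ?thesis
      using True third_and_fourth_colour_iff[of "ss ! 0" "ss ! 1" "ss ! 2" "ss ! 3"] nth_order_of_rest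
      by (auto simp: rainbow_orders_iff leading_orders_iff)
  qed (auto simp: rainbow_orders_iff leading_orders_iff)
qed

lemma even_card_leading_orders_iff:
  "even (card (leading_orders A B)) \<longleftrightarrow> even (card (rainbow_orders colour_A colour_B rest))"
proof -
  define exchange_order where "exchange_order ss =
    (if colour_A (ss ! 2) = 1 then list_swap 0 2 ss
     else if colour_B (ss ! 3) = 2 then list_swap 1 3 ss else ss)" for ss
  have "exchange_order ss \<in> leading_orders A B \<and> exchange_order (exchange_order ss) = ss"
    if "ss \<in> leading_orders A B" for ss
    using that nth_order_of_rest(1)[of ss]
    by (simp add: exchange_order_def leading_orders_iff nth_list_swap
        insert_commute[of "ss ! 0" "ss ! 2"] insert_commute[of "ss ! Suc 0" "ss ! 3"])
  moreover have "finite (leading_orders A B)"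
  proof (rule finite_subset)
    show "leading_orders A B \<subseteq> transversals (\<lambda>_ _. True) rest"
      by (auto simp: leading_orders_iff transversals_def)
  qed (simp add: finite_transversals finite_rest)
  ultimately have "even (card (leading_orders A B)) \<longleftrightarrow>
      even (card {ss \<in> leading_orders A B. exchange_order ss = ss})"
    by (intro even_card_iff_even_card_fixpoints) auto
  also have "{ss \<in> leading_orders A B. exchange_order ss = ss} =
      {ss \<in> leading_orders A B. colour_A (ss ! 2) \<noteq> 1 \<and> colour_B (ss ! 3) \<noteq> 2}"
    using nth_order_of_rest(1)
    by (intro Collect_cong conj_cong refl)
      (simp add: exchange_order_def leading_orders_iff list_swap_eq_iff)
  finally show ?thesis by (simp add: rainbow_orders_eq)
qed

lemma colours_eq_if_odd_leading_orders:
  assumes "odd (card (leading_orders A B))" "s \<in> rest"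
  shows "colour_A s = colour_B s"
proof (rule eq_if_odd_card_rainbow_orders[of rest colour_A colour_B])
  show "odd (card (rainbow_orders colour_A colour_B rest))"
    using assms(1) by (simp add: even_card_leading_orders_iff)
qed (use assms(2) colours_range eq_if_colours_eq card_rest finite_rest in \<open>simp_all only:\<close>)

end

theorem ex_colourful_crown:
  assumes "kneser_colouring m 4 c"
  shows "\<exists>A B. A \<union> B \<subseteq> {1..2*m+4} \<and> A \<inter> B = {} \<and> card A = m \<and> card B = m \<and>
    (\<forall>s \<in> {1..2*m+4} - (A \<union> B). c (insert s A) = c (insert s B))"
proof -
  interpret kneser_colouring m 4 c by (fact assms)
  obtain A B where AB: "A \<union> B \<subseteq> {1..2*m+4}" "A \<inter> B = {}" "card A = m" "card B = m"
    and odd: "odd (card (leading_orders A B))"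
    using obtain_odd_leading_orders .
  interpret kneser_four_colouring_pair m c A B by unfold_locales (fact AB)+
  show ?thesis using AB colours_eq_if_odd_leading_orders[OF odd] unfolding rest_def by blast
qed

section \<open>Homomorphisms to shift graphs\<close>

lemma shift_adj_fst_neq:
  assumes "p \<in> shift_vertices n" "q \<in> shift_vertices n" "shift_adj p q"
  shows "fst p \<noteq> fst q"
  using assms by (auto simp: shift_vertices_def shift_adj_def)

lemma card_shift_crown_le_3:
  fixes F G :: "'a \<Rightarrow> nat \<times> nat"
  assumes "finite S" and fst_eq: "\<And>s. s \<in> S \<Longrightarrow> fst (F s) = fst (G s)"
    and inj: "inj_on (\<lambda>s. fst (F s)) S"
    and adj: "\<And>s s'. s \<in> S \<Longrightarrow> s' \<in> S \<Longrightarrow> s \<noteq> s' \<Longrightarrow> shift_adj (F s) (G s')"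
  shows "card S \<le> 3"
proof -
  define P where "P = {(s, s') \<in> S \<times> S. snd (F s) = fst (F s')}"
  define Q where "Q = {(s, s') \<in> S \<times> S. fst (F s) = snd (G s')}"
  define D where "D = {(s, s') \<in> S \<times> S. s = s'}"
  have "P \<subseteq> S \<times> S" "Q \<subseteq> S \<times> S" by (auto simp: P_def Q_def)
  then have "finite (P \<union> Q)" using assms(1) by (meson finite_SigmaI finite_UnI finite_subset)
  moreover have "S \<times> S - D \<subseteq> P \<union> Q"
    using adj fst_eq by (fastforce simp: D_def P_def Q_def shift_adj_def)
  ultimately have "card (S \<times> S - D) \<le> card (P \<union> Q)" by (rule card_mono)
  also have "\<dots> \<le> card P + card Q" by (rule card_Un_le)
  also have "card P \<le> card S"
    by (rule card_inj_on_le[where f = fst])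
      (use assms(1) inj_onD[OF inj] in \<open>auto simp: P_def intro!: inj_onI\<close>)
  also have "card Q \<le> card S"
    by (rule card_inj_on_le[where f = snd])
      (use assms(1) inj_onD[OF inj] in \<open>auto simp: Q_def intro!: inj_onI\<close>)
  also have "card (S \<times> S - D) = card S * card S - card S"
  proof -
    have "D = (\<lambda>s. (s, s)) ` S" by (auto simp: D_def)
    then show ?thesis
      using assms(1)
      by (subst card_Diff_subset) (auto simp: card_cartesian_product card_image inj_on_def)
  qed
  finally have "card S * card S \<le> 3 * card S" by linarith
  then show ?thesis by (cases "card S = 0") simp_all
qed

lemma kneser_colouring_if_hom_shift:
  assumes "graph_hom (kneser_vertices (2*m+t) (Suc m)) kneser_adj (shift_vertices t) shift_adj f"
  shows "kneser_colouring m t (\<lambda>Y. fst (f Y))"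
proof
  let ?V = "kneser_vertices (2*m+t) (Suc m)"
  have image: "f Y \<in> shift_vertices t" if "Y \<in> ?V" for Y
    using assms that by (simp add: graph_hom_def)
  then show "fst (f Y) \<in> {1..t}" if "Y \<in> ?V" for Y
    using that by (force simp: shift_vertices_def)
  show "fst (f Y) \<noteq> fst (f Z)" if "Y \<in> ?V" "Z \<in> ?V" "kneser_adj Y Z" for Y Z
    by (rule shift_adj_fst_neq[OF image image]) (use assms that in \<open>simp_all add: graph_hom_def\<close>)
qed

theorem no_hom_kneser_shift:
  "\<not> graph_hom (kneser_vertices (2*m+4) (Suc m)) kneser_adj (shift_vertices 4) shift_adj f"
proof
  assume hom: "graph_hom (kneser_vertices (2*m+4) (Suc m)) kneser_adj (shift_vertices 4) shift_adj f"
  then have colouring: "kneser_colouring m 4 (\<lambda>Y. fst (f Y))" by (rule kneser_colouring_if_hom_shift)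
  obtain A B where AB: "A \<union> B \<subseteq> {1..2*m+4}" "A \<inter> B = {}" "card A = m" "card B = m"
    and same_colour: "\<forall>s \<in> {1..2*m+4} - (A \<union> B). fst (f (insert s A)) = fst (f (insert s B))"
    using ex_colourful_crown[OF colouring] by blast
  interpret kneser_four_colouring_pair m "\<lambda>Y. fst (f Y)" A B
    using colouring AB
    by (intro kneser_four_colouring_pair.intro kneser_four_colouring_pair_axioms.intro)
  have "card rest \<le> 3"
  proof (rule card_shift_crown_le_3[OF finite_rest])
    show "fst (f (insert s A)) = fst (f (insert s B))" if "s \<in> rest" for s
      using same_colour that by (simp add: rest_def)
    then show "inj_on (\<lambda>s. fst (f (insert s A))) rest"
      using eq_if_colours_eq by (intro inj_onI) metis
    show "shift_adj (f (insert s A)) (f (insert s' B))" if "s \<in> rest" "s' \<in> rest" "s \<noteq> s'" for s s'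
      using hom vertices(1)[OF that(1)] vertices(2)[OF that(2)] adjacent[OF that]
      by (simp add: graph_hom_def)
  qed
  then show False by (simp add: card_rest)
qed

section \<open>Schrijver graphs\<close>

lemma graph_hom_comp:
  assumes "graph_hom V E W F f" "graph_hom W F X H g"
  shows "graph_hom V E X H (g \<circ> f)"
  using assms by (simp add: graph_hom_def)

lemma graph_hom_subset:
  assumes "graph_hom V E W F f" "U \<subseteq> V"
  shows "graph_hom U E W F f"
  using assms unfolding graph_hom_def by blast

lemma remove_Max_schrijver_vertex:
  assumes "A \<in> schrijver_vertices (Suc (Suc n)) (Suc k)"
  shows "A - {Max A} \<in> schrijver_vertices n k"
proof -
  have A: "A \<subseteq> {1..Suc (Suc n)}" "card A = Suc k" "stable_set (Suc (Suc n)) A"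
    using assms by (auto simp: schrijver_vertices_def kneser_vertices_def)
  then have "finite A" "A \<noteq> {}" by (auto intro: finite_subset)
  then have Max: "Max A \<in> A" "\<And>a. a \<in> A \<Longrightarrow> a \<le> Max A" by auto
  have bound: "Max A \<le> Suc (Suc n)" using A(1) Max(1) by auto
  have gap: "a + 2 \<le> Max A" if "a \<in> A - {Max A}" for a
  proof -
    have "a < Max A" using that Max(2)[of a] by (simp add: le_less)
    moreover from this have "a \<in> {1..<Suc (Suc n)}" using that A(1) bound by auto
    then have "Max A \<noteq> Suc a" using that A(3) Max(1) by (auto simp: stable_set_def)
    ultimately show ?thesis by simp
  qed
  have "\<not> (1 \<in> A - {Max A} \<and> n \<in> A - {Max A})"
  proof
    assume ends: "1 \<in> A - {Max A} \<and> n \<in> A - {Max A}"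
    then have "Max A = Suc (Suc n)" using gap[of n] bound by simp
    then show False using A(3) ends Max(1) by (auto simp: stable_set_def)
  qed
  then have "stable_set n (A - {Max A})" using A(3) by (auto simp: stable_set_def)
  moreover have "A - {Max A} \<subseteq> {1..n}" using gap bound A(1) by fastforce
  ultimately show ?thesis
    using A(2) \<open>finite A\<close> Max(1) by (simp add: schrijver_vertices_def kneser_vertices_def)
qed

lemma graph_hom_remove_Max:
  "graph_hom (schrijver_vertices (Suc (Suc n)) (Suc k)) kneser_adj (schrijver_vertices n k) kneser_adj
     (\<lambda>A. A - {Max A})"
  using remove_Max_schrijver_vertex by (auto simp: graph_hom_def kneser_adj_def)

text \<open>The long diagonals of the hexagon form a triangle in \<open>SG(6,2)\<close> and go to a directed triangle
  on \<open>1, 2, 3\<close>. Every odd short diagonal goes to an arc into 4 and every even one to an arc out of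
  4, which makes them adjacent; the other end of that arc is where it meets the image of the
  disjoint long diagonal.\<close>
definition hexagon_arc :: "nat set \<Rightarrow> nat \<times> nat" where
  "hexagon_arc A =
    (if A = {1,4} then (1,3) else if A = {2,5} then (2,1) else if A = {3,6} then (3,2)
     else if A = {1,3} then (1,4) else if A = {1,5} then (2,4) else if A = {3,5} then (3,4)
     else if A = {2,6} then (4,1) else if A = {4,6} then (4,2) else (4,3))"

lemma schrijver_vertices_6_2:
  "schrijver_vertices 6 2 \<subseteq> {{1,4},{2,5},{3,6},{1,3},{1,5},{3,5},{2,6},{4,6},{2,4}}"
proof
  fix A assume "A \<in> schrijver_vertices 6 2"
  then have A: "A \<subseteq> {1..6}" "card A = 2" "stable_set 6 A"
    by (auto simp: schrijver_vertices_def kneser_vertices_def)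
  then obtain a b where ab: "A = {a, b}" "a < b"
    by (metis card_2_iff insert_commute linorder_neqE_nat)
  have "1 \<le> a" "b \<le> 6" using A(1) ab by auto
  moreover have "b \<noteq> Suc a" "\<not> (a = 1 \<and> b = 6)" using A ab by (auto simp: stable_set_def)
  ultimately have "a = 1 \<and> b = 3 \<or> a = 1 \<and> b = 4 \<or> a = 1 \<and> b = 5 \<or> a = 2 \<and> b = 4 \<or> a = 2 \<and> b = 5
      \<or> a = 2 \<and> b = 6 \<or> a = 3 \<and> b = 5 \<or> a = 3 \<and> b = 6 \<or> a = 4 \<and> b = 6"
    using \<open>a < b\<close> by presburger
  then show "A \<in> {{1,4},{2,5},{3,6},{1,3},{1,5},{3,5},{2,6},{4,6},{2,4}}"
    unfolding \<open>A = {a, b}\<close> by (elim disjE conjE) simp_all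
qed

lemma graph_hom_hexagon_arc:
  "graph_hom (schrijver_vertices 6 2) kneser_adj (shift_vertices 4) shift_adj hexagon_arc"
proof (rule graph_hom_subset[OF _ schrijver_vertices_6_2])
  have arcs: "hexagon_arc {1,4} = (1,3)" "hexagon_arc {2,5} = (2,1)" "hexagon_arc {3,6} = (3,2)"
    "hexagon_arc {1,3} = (1,4)" "hexagon_arc {1,5} = (2,4)" "hexagon_arc {3,5} = (3,4)"
    "hexagon_arc {2,6} = (4,1)" "hexagon_arc {4,6} = (4,2)" "hexagon_arc {2,4} = (4,3)"
    by (simp_all add: hexagon_arc_def doubleton_eq_iff)
  have adj: "kneser_adj {a, b} {c, d} \<longleftrightarrow> a \<noteq> c \<and> a \<noteq> d \<and> b \<noteq> c \<and> b \<noteq> d" for a b c d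
    by (auto simp: kneser_adj_def)
  show "graph_hom {{1,4},{2,5},{3,6},{1,3},{1,5},{3,5},{2,6},{4,6},{2,4}} kneser_adj
      (shift_vertices 4) shift_adj hexagon_arc"
    by (simp only: graph_hom_def ball_simps arcs adj) (simp add: shift_adj_def shift_vertices_def)
qed

theorem ex_hom_schrijver_shift:
  assumes "k \<ge> 2"
  shows "\<exists>f. graph_hom (schrijver_vertices (2*k+2) k) kneser_adj (shift_vertices 4) shift_adj f"
  using assms
proof (induction k rule: dec_induct)
  case base
  show ?case using graph_hom_hexagon_arc by auto
next
  case (step k)
  then show ?case using graph_hom_comp[OF graph_hom_remove_Max[of "2 * k + 2" k]] by auto
qed

theorem mainTheorem3:
  shows "(\<forall>k::nat. k \<ge> 2 \<longrightarrow>
            (\<exists>f. graph_hom (schrijver_vertices (2*k+2) k) kneser_adj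
                              (shift_vertices 4) shift_adj f))
       \<and> (\<forall>k::nat. k \<ge> 1 \<longrightarrow>
            \<not> (\<exists>f. graph_hom (kneser_vertices (2*k+2) k) kneser_adj
                              (shift_vertices 4) shift_adj f))"
proof (intro conjI allI impI)
  fix k :: nat assume "k \<ge> 2"
  then show "\<exists>f. graph_hom (schrijver_vertices (2*k+2) k) kneser_adj (shift_vertices 4) shift_adj f"
    by (rule ex_hom_schrijver_shift)
next
  fix k :: nat assume "k \<ge> 1"
  then obtain m where "k = Suc m" by (cases k) auto
  then have "2*k+2 = 2*m+4" by simp
  then show "\<not> (\<exists>f. graph_hom (kneser_vertices (2*k+2) k) kneser_adj
      (shift_vertices 4) shift_adj f)"
    using no_hom_kneser_shift \<open>k = Suc m\<close> by metis
qed

end
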